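(* Let $n\ge1$, $\lambda\in\mathbb{D}$, and let $\sigma_{n,\lambda}=(\lambda,\lambda,\dots,\lambda)$ ($n$ times). Then $$I\big(\sigma_{n,\lambda},H^2,B^{1/2}_{2,2}\big)\ge\sqrt{\frac{n}{1-|\lambda|}}\left[\frac{(1+|\lambda|)^2-\frac2n-\frac{2|\lambda|}{n}}{2(1+|\lambda|)}\right]^{1/2}$$ (whenever the bracket is nonnegative).
   Context: $\mathbb{D}$ is the open unit disc, $\hat f(k)$ the $k$-th Taylor coefficient. $\|f\|_{H^2}^2=\sum_{k\ge0}|\hat f(k)|^2$; the Dirichlet space $B^{1/2}_{2,2}=\{f:\|f\|^2_{B^{1/2}_{2,2}}=\sum_{k\ge0}(k+1)|\hat f(k)|^2<\infty\}$. For $\lambda\in\mathbb{D}$, $b_\lambda(z)=\frac{\lambda-z}{1-\bar\lambda z}$; for a finite sequence $\sigma=(\lambda_1,\dots,\lambda_n)$ in $\mathbb{D}$ (repetitions allowed), $B_\sigma=\prod_j b_{\lambda_j}$, and "$g_{|\sigma}=f_{|\sigma}$" means $f-g\in B_\sigma\mathrm{Hol}(\mathbb{D})$. $I(\sigma,X,Y)=\sup_{f\in X,\|f\|_X\le1}\inf\{\|g\|_Y: g\in Y,\ g_{|\sigma}=f_{|\sigma}\}$. *)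

theory Defs
  imports "HOL-Analysis.Analysis"
begin

definition taylor_coeff :: "(complex \<Rightarrow> complex) \<Rightarrow> nat \<Rightarrow> complex" where
  "taylor_coeff f k = (deriv ^^ k) f 0 / of_nat (fact k)"

definition in_H2 :: "(complex \<Rightarrow> complex) \<Rightarrow> bool" where
  "in_H2 f \<longleftrightarrow> f holomorphic_on ball 0 1 \<and> summable (\<lambda>k. (norm (taylor_coeff f k))\<^sup>2)"

definition H2_norm :: "(complex \<Rightarrow> complex) \<Rightarrow> real" where
  "H2_norm f = sqrt (\<Sum>k. (norm (taylor_coeff f k))\<^sup>2)"

definition in_Dirichlet :: "(complex \<Rightarrow> complex) \<Rightarrow> bool" where
  "in_Dirichlet f \<longleftrightarrow> f holomorphic_on ball 0 1 \<and>
     summable (\<lambda>k. real (k + 1) * (norm (taylor_coeff f k))\<^sup>2)"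

definition Dirichlet_norm :: "(complex \<Rightarrow> complex) \<Rightarrow> real" where
  "Dirichlet_norm f = sqrt (\<Sum>k. real (k + 1) * (norm (taylor_coeff f k))\<^sup>2)"

definition blaschke_factor :: "complex \<Rightarrow> complex \<Rightarrow> complex" where
  "blaschke_factor l z = (l - z) / (1 - cnj l * z)"

definition blaschke_prod :: "complex list \<Rightarrow> complex \<Rightarrow> complex" where
  "blaschke_prod \<sigma> z = prod_list (map (\<lambda>l. blaschke_factor l z) \<sigma>)"

text \<open>g restricted to sigma equals f restricted to sigma: f - g \<in> B_sigma Hol(D).\<close>
definition same_trace :: "complex list \<Rightarrow> (complex \<Rightarrow> complex) \<Rightarrow> (complex \<Rightarrow> complex) \<Rightarrow> bool" where
  "same_trace \<sigma> f g \<longleftrightarrow> (\<exists>h. h holomorphic_on ball 0 1 \<and>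
       (\<forall>z\<in>ball 0 1. f z - g z = blaschke_prod \<sigma> z * h z))"

definition interp_const ::
  "complex list \<Rightarrow> ((complex \<Rightarrow> complex) \<Rightarrow> bool) \<Rightarrow> ((complex \<Rightarrow> complex) \<Rightarrow> real)
     \<Rightarrow> ((complex \<Rightarrow> complex) \<Rightarrow> bool) \<Rightarrow> ((complex \<Rightarrow> complex) \<Rightarrow> real) \<Rightarrow> ereal" where
  "interp_const \<sigma> inX normX inY normY =
     (SUP f\<in>{f. inX f \<and> normX f \<le> 1}.
        INF g\<in>{g. inY g \<and> same_trace \<sigma> f g}. ereal (normY g))"

end

theory Submission
  imports Defs "HOL-Complex_Analysis.Complex_Analysis"
begin

text \<open>
  For $n = 1$ the bracket is negative, so $m = n - 1 \ge 1$. Let $F = (b_\<lambda>^m)'$, which belongs to the model space $H^2 \ominus b_\<lambda>^n H^2$.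
  Every $g$ with the same trace as $f = F / \|F\|_{H^2}$ satisfies
  $\langle g, F \rangle = \langle f, F \rangle = \|F\|_{H^2}$ in the Cauchy pairing, so by the
  Cauchy--Schwarz inequality its squared Dirichlet norm is at least
  $\|F\|_{H^2}^2 / \sum_k |\hat F(k)|^2 / (k + 1)$. The denominator is the normalised Dirichlet
  integral of $b_\<lambda>^m$, namely $m$, while
  $\|F\|_{H^2}^2 = m^2 (1 + |\<lambda>|^2) / (1 - |\<lambda>|^2)$. The resulting bound
  $m (1 + |\<lambda>|^2) / (1 - |\<lambda>|^2)$ on the square is larger than the required one. All pairings
  are evaluated by residues on a circle of radius between $|\<lambda>|$ and $1$, where the conjugate of
  $b_\<lambda>(1 / \bar z)$ is $1 / b_\<lambda>(z)$.
\<close>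

section \<open>Taylor coefficients at the origin\<close>

lemma taylor_coeff_sums:
  assumes "f holomorphic_on ball 0 R" "norm z < R"
  shows "(\<lambda>k. taylor_coeff f k * z ^ k) sums f z"
  using holomorphic_power_series[OF assms(1), of z] assms(2) by (simp add: taylor_coeff_def)

lemma taylor_coeff_deriv: "taylor_coeff (deriv f) k = of_nat (Suc k) * taylor_coeff f (Suc k)"
proof -
  have "(deriv ^^ k) (deriv f) = (deriv ^^ Suc k) f"
    by (metis comp_apply funpow_Suc_right)
  moreover have "of_nat (fact (Suc k)) = (of_nat (Suc k) * of_nat (fact k) :: complex)"
    by (simp only: fact_Suc of_nat_mult of_nat_id)
  ultimately show ?thesis
    unfolding taylor_coeff_def by (simp only: mult_divide_mult_cancel_left times_divide_eq_right
        of_nat_eq_0_iff nat.distinct simp_thms)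
qed

lemma taylor_coeff_diff:
  assumes "f holomorphic_on ball 0 1" "g holomorphic_on ball 0 1"
  shows "taylor_coeff (\<lambda>z. f z - g z) k = taylor_coeff f k - taylor_coeff g k"
  using higher_deriv_diff[OF assms, of 0 k] by (simp add: taylor_coeff_def diff_divide_distrib)

lemma taylor_coeff_cmult:
  assumes "f holomorphic_on ball 0 1"
  shows "taylor_coeff (\<lambda>z. c * f z) k = c * taylor_coeff f k"
  using higher_deriv_cmult[OF assms, of 0 k c] by (simp add: taylor_coeff_def)

section \<open>Coefficient pairings as contour integrals\<close>

text \<open>Expand \<open>V\<close> in negative powers of z and integrate term by term: Cauchy's
  formula for u(z) / z^(k+1) extracts the k-th coefficient of \<open>u\<close>. Only the values of
  \<open>V\<close> on the circle enter, so \<open>V\<close> may be built from complex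
  conjugates.\<close>

lemma coeff_pairing_sums:
  fixes u V :: "complex \<Rightarrow> complex" and d :: "nat \<Rightarrow> complex"
  assumes u: "u holomorphic_on ball 0 1" and \<rho>: "0 < \<rho>" "\<rho> < 1"
    and d: "summable (\<lambda>k. norm (d k) / \<rho> ^ k)"
    and V: "\<And>z. norm z = \<rho> \<Longrightarrow> (\<lambda>k. d k / z ^ k) sums V z"
    and I: "((\<lambda>z. u z * V z / z) has_contour_integral 2 * pi * \<i> * I) (circlepath 0 \<rho>)"
  shows "(\<lambda>k. taylor_coeff u k * d k) sums I"
proof -
  have hol: "u holomorphic_on ball 0 \<rho>" and cont: "continuous_on (cball 0 \<rho>) u"
    using u \<rho> by (auto intro!: holomorphic_on_imp_continuous_on elim!: holomorphic_on_subset)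
  have "continuous_on (sphere 0 \<rho>) u"
    using cont by (rule continuous_on_subset) auto
  then have "compact (u ` sphere 0 \<rho>)"
    by (rule compact_continuous_image) auto
  then obtain C where C: "\<And>z. norm z = \<rho> \<Longrightarrow> norm (u z) \<le> C"
    using compact_imp_bounded by (metis bounded_iff image_eqI mem_sphere_0)
  \<comment> \<open>The terms of u V / z are grouped so that the factor u(z) / z is bounded by C /
    \<rho> on the circle and the rest has modulus norm (d k) / \<rho>^k, a summable
    majorant.\<close>
  define t where "t k z = u z / z * (d k / z ^ k)" for k z
  have t_int: "(t k has_contour_integral 2 * pi * \<i> * (taylor_coeff u k * d k)) (circlepath 0 \<rho>)" for k
  proof -
    have "((\<lambda>z. d k * (u z / (z - 0) ^ Suc k)) has_contour_integral
        d k * (2 * pi * \<i> / fact k * (deriv ^^ k) u 0)) (circlepath 0 \<rho>)"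
      by (intro has_contour_integral_lmul
          Cauchy_has_contour_integral_higher_derivative_circlepath cont hol) (use \<rho> in auto)
    then show ?thesis
      by (simp add: t_def[abs_def] taylor_coeff_def field_simps)
  qed
  have "uniform_limit (sphere 0 \<rho>) (\<lambda>N z. \<Sum>k<N. t k z) (\<lambda>z. \<Sum>k. t k z) sequentially"
  proof (rule Weierstrass_m_test)
    show "summable (\<lambda>k. C / \<rho> * (norm (d k) / \<rho> ^ k))"
      using d by (rule summable_mult)
    show "norm (t k z) \<le> C / \<rho> * (norm (d k) / \<rho> ^ k)" if "z \<in> sphere 0 \<rho>" for k z
      unfolding t_def norm_mult norm_divide norm_power
      using that C[of z] \<rho> by (auto intro!: mult_right_mono divide_right_mono)
  qed
  moreover have "(\<Sum>k. t k z) = u z * V z / z" if "z \<in> sphere 0 \<rho>" for z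
    using sums_mult[OF V, of z "u z / z"] that by (auto simp: t_def sums_iff)
  ultimately have unif: "uniform_limit (sphere 0 \<rho>) (\<lambda>N z. \<Sum>k<N. t k z) (\<lambda>z. u z * V z / z) sequentially"
    by (metis (no_types, lifting) uniform_limit_cong')
  have sum_int: "((\<lambda>z. \<Sum>k<N. t k z) has_contour_integral
      (\<Sum>k<N. 2 * pi * \<i> * (taylor_coeff u k * d k))) (circlepath 0 \<rho>)" for N
    by (intro has_contour_integral_sum t_int) auto
  have "(\<lambda>N. contour_integral (circlepath 0 \<rho>) (\<lambda>z. \<Sum>k<N. t k z)) \<longlonglongrightarrow>
      contour_integral (circlepath 0 \<rho>) (\<lambda>z. u z * V z / z)"
    by (rule contour_integral_uniform_limit_circlepath(2)
          [OF always_eventually[OF allI[OF has_contour_integral_integrable[OF sum_int]]] unif])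
      (use \<rho> in auto)
  then have "(\<lambda>N. \<Sum>k<N. 2 * pi * \<i> * (taylor_coeff u k * d k)) \<longlonglongrightarrow> 2 * pi * \<i> * I"
    using contour_integral_unique[OF sum_int] contour_integral_unique[OF I] by simp
  then have "(\<lambda>k. 2 * pi * \<i> * (taylor_coeff u k * d k)) sums (2 * pi * \<i> * I)"
    by (simp add: sums_def)
  from sums_mult[OF this, of "1 / (2 * pi * \<i>)"] show ?thesis
    by simp
qed

lemma summable_norm_taylor_coeff_divide:
  assumes v: "v holomorphic_on ball 0 R" and \<rho>: "0 < \<rho>" "1 / \<rho> < R"
  shows "summable (\<lambda>k. norm (taylor_coeff v k) / \<rho> ^ k)"
proof -
  \<comment> \<open>Convergence at the slightly larger radius \<open>x\<close> gives absolute
    convergence at 1 / \<rho>.\<close>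
  obtain x where x: "1 / \<rho> < x" "x < R"
    using \<rho> dense by blast
  have "x > 0" using x \<rho> by (meson divide_pos_pos less_trans zero_less_one)
  then have "summable (\<lambda>k. taylor_coeff v k * of_real x ^ k)"
    using taylor_coeff_sums[OF v, of "of_real x"] x by (auto simp: sums_iff)
  then have "summable (\<lambda>k. norm (taylor_coeff v k * of_real (1 / \<rho>) ^ k))"
    by (rule powser_insidea) (use x \<rho> \<open>x > 0\<close> in \<open>auto simp: norm_divide\<close>)
  moreover have "norm (taylor_coeff v k * of_real (1 / \<rho>) ^ k) = norm (taylor_coeff v k) / \<rho> ^ k" for k
    using \<rho> by (simp add: norm_mult norm_power norm_divide power_one_over)
  ultimately show ?thesis by simp
qed

text \<open>Reflection z -> 1 / cnj z sends the circle of radius \<rho> to that of radius 1 /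
  \<rho>, still inside the disc of convergence. Conjugating there yields a series in 1 / z, the form
  that \<open>coeff_pairing_sums\<close> expects of \<open>V\<close>.\<close>

lemma cnj_taylor_coeff_sums:
  assumes v: "v holomorphic_on ball 0 R" and \<rho>: "1 / \<rho> < R" and z: "norm z = \<rho>"
  shows "(\<lambda>k. cnj (taylor_coeff v k) / z ^ k) sums cnj (v (1 / cnj z))"
proof -
  have "(\<lambda>k. taylor_coeff v k * (1 / cnj z) ^ k) sums v (1 / cnj z)"
    by (rule taylor_coeff_sums[OF v]) (use z \<rho> in \<open>auto simp: norm_divide\<close>)
  then have "(\<lambda>k. cnj (taylor_coeff v k * (1 / cnj z) ^ k)) sums cnj (v (1 / cnj z))"
    by (simp only: sums_cnj)
  then show ?thesis
    by (simp add: power_one_over)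
qed

text \<open>This replaces the H^2 inner product on the unit circle. Integrating on a smaller circle
  requires nothing of \<open>u\<close> at the boundary; in exchange \<open>v\<close> has to extend
  holomorphically past the closed disc.\<close>

lemma coeff_cnj_pairing_sums:
  fixes u v :: "complex \<Rightarrow> complex"
  assumes u: "u holomorphic_on ball 0 1" and v: "v holomorphic_on ball 0 R"
    and \<rho>: "0 < \<rho>" "\<rho> < 1" "1 / \<rho> < R"
    and I: "((\<lambda>z. u z * cnj (v (1 / cnj z)) / z) has_contour_integral 2 * pi * \<i> * I)
              (circlepath 0 \<rho>)"
  shows "(\<lambda>k. taylor_coeff u k * cnj (taylor_coeff v k)) sums I"
  by (rule coeff_pairing_sums[OF u \<rho>(1,2) _ cnj_taylor_coeff_sums[OF v \<rho>(3)] I])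
    (use summable_norm_taylor_coeff_divide[OF v \<rho>(1,3)] in simp_all)

section \<open>Blaschke factors, their reflection and derivatives\<close>

text \<open>With division by zero equal to zero, both sides are 0 at z = l and where cnj l * z = 1,
  so z \<noteq> 0 is the only restriction.\<close>

lemma blaschke_factor_reflect:
  assumes "z \<noteq> 0"
  shows "cnj (blaschke_factor l (1 / cnj z)) = 1 / blaschke_factor l z"
  using assms by (cases "z = l"; cases "cnj l * z = 1") (auto simp: blaschke_factor_def field_simps)

lemma has_field_derivative_blaschke_factor:
  assumes "1 - cnj l * z \<noteq> 0"
  shows "(blaschke_factor l has_field_derivative
           - of_real (1 - (norm l)\<^sup>2) / (1 - cnj l * z)\<^sup>2) (at z)"
proof -
  have "of_real (1 - (norm l)\<^sup>2) = 1 - l * cnj l"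
    by (simp only: of_real_diff complex_norm_square of_real_1)
  moreover have "(blaschke_factor l has_field_derivative
      ((0 - 1) * (1 - cnj l * z) - (l - z) * (0 - cnj l * 1)) / ((1 - cnj l * z) * (1 - cnj l * z))) (at z)"
    unfolding blaschke_factor_def[abs_def]
    by (rule DERIV_divide) (use assms in \<open>auto intro!: derivative_eq_intros\<close>)
  ultimately show ?thesis
    by (simp add: power2_eq_square algebra_simps)
qed

lemma deriv_blaschke_factor_power:
  assumes "1 - cnj l * z \<noteq> 0"
  shows "deriv (\<lambda>z. blaschke_factor l z ^ Suc p) z =
    - of_nat (Suc p) * of_real (1 - (norm l)\<^sup>2) * blaschke_factor l z ^ p / (1 - cnj l * z)\<^sup>2"
proof -
  have "((\<lambda>z. blaschke_factor l z ^ Suc p) has_field_derivative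
      of_nat (Suc p) * (- of_real (1 - (norm l)\<^sup>2) / (1 - cnj l * z)\<^sup>2 * blaschke_factor l z ^ p)) (at z)"
    using DERIV_power[OF has_field_derivative_blaschke_factor[OF assms], of "Suc p"] by simp
  from DERIV_imp_deriv[OF this] show ?thesis
    by (simp only: mult.assoc times_divide_eq_left times_divide_eq_right minus_mult_left[symmetric]
        minus_mult_right[symmetric] minus_divide_left[symmetric])
qed

lemma blaschke_denominator_nonzero:
  assumes "norm l < 1" "norm z \<le> 1"
  shows "1 - cnj l * z \<noteq> 0" "1 \<noteq> cnj l * z"
proof -
  have "norm (cnj l * z) \<le> norm l * 1"
    unfolding norm_mult complex_mod_cnj using assms(2) by (intro mult_left_mono) auto
  then show "1 - cnj l * z \<noteq> 0" "1 \<noteq> cnj l * z"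
    using assms(1) by auto
qed

lemma holomorphic_blaschke_factor:
  assumes "\<And>z. z \<in> S \<Longrightarrow> 1 - cnj l * z \<noteq> 0"
  shows "blaschke_factor l holomorphic_on S"
  unfolding blaschke_factor_def[abs_def] using assms by (intro holomorphic_intros) auto

text \<open>The circle of radius \<rho> encloses l, and its reflection stays inside the pole 1 / cnj
  l of the Blaschke factor.\<close>

lemma blaschke_radii:
  assumes "norm l < 1"
  obtains \<rho> R where "0 < \<rho>" "norm l < \<rho>" "\<rho> < 1" "1 / \<rho> < R" "1 < R"
    "\<And>z. z \<in> ball 0 R \<Longrightarrow> 1 - cnj l * z \<noteq> 0"
proof -
  define \<rho> where "\<rho> = (1 + norm l) / 2"
  \<comment> \<open>The reciprocal of the midpoint between norm l and \<rho>. It lies strictly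
    between 1 / \<rho> and 1 / norm l, and makes sense for l = 0 too.\<close>
  define R where "R = 2 / (\<rho> + norm l)"
  have \<rho>: "0 < \<rho>" "norm l < \<rho>" "\<rho> < 1"
    using assms by (auto simp: \<rho>_def add_nonneg_pos intro: add_pos_nonneg)
  have R: "1 / \<rho> < R"
    using \<rho> by (simp add: R_def divide_simps add_pos_nonneg)
  moreover have "1 < 1 / \<rho>"
    using \<rho> by simp
  moreover have "1 - cnj l * z \<noteq> 0" if "z \<in> ball 0 R" for z
  proof
    assume "1 - cnj l * z = 0"
    then have "1 = norm l * norm z"
      by (metis complex_mod_cnj eq_iff_diff_eq_0 norm_mult norm_one)
    also have "\<dots> \<le> norm l * R"
      using that by (intro mult_left_mono) auto
    also have "\<dots> < 1"
      using \<rho> by (simp add: R_def add_pos_nonneg)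
    finally show False by simp
  qed
  ultimately show ?thesis
    using that[of \<rho> R] \<rho> by (meson less_trans)
qed

lemma holomorphic_deriv_blaschke_factor_power:
  assumes "\<And>z. z \<in> ball 0 R \<Longrightarrow> 1 - cnj l * z \<noteq> 0"
  shows "deriv (\<lambda>z. blaschke_factor l z ^ m) holomorphic_on ball 0 R"
  by (intro holomorphic_deriv holomorphic_on_power holomorphic_blaschke_factor) (use assms in auto)

text \<open>The conjugate of 1 - cnj l / cnj z is (z - l) / z, so the reflected derivative agrees
  with a rational function of z whose only pole in the unit disc is at l, of order p + 2.\<close>

lemma cnj_deriv_blaschke_factor_power_reflect:
  fixes p :: nat
  assumes "z \<noteq> 0" "1 - cnj l * (1 / cnj z) \<noteq> 0"
  shows "cnj (deriv (\<lambda>z. blaschke_factor l z ^ Suc p) (1 / cnj z)) =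
    - of_nat (Suc p) * of_real (1 - (norm l)\<^sup>2) * z\<^sup>2 / (blaschke_factor l z ^ p * (z - l)\<^sup>2)"
proof -
  have "(1 - l / z)\<^sup>2 = (z - l)\<^sup>2 / z\<^sup>2"
    using assms by (simp add: diff_divide_distrib flip: power_divide)
  then show ?thesis
    unfolding deriv_blaschke_factor_power[OF assms(2)]
    by (simp add: blaschke_factor_reflect[OF assms(1)] power_one_over del: of_nat_Suc of_real_diff)
qed

section \<open>The three pairings with the derivative of a Blaschke power\<close>

text \<open>The zero of order p + 2 of \<open>u\<close> at l cancels the pole of the reflected
  derivative, leaving a holomorphic integrand, and Cauchy's theorem applies. Since \<open>h\<close>
  is merely holomorphic, this covers all of B_\<sigma> Hol(D), as \<open>same_trace\<close>
  demands.\<close>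

lemma pairing_blaschke_multiple_sums_0:
  assumes l: "norm l < 1" and h: "h holomorphic_on ball 0 1" and u: "u holomorphic_on ball 0 1"
    and uh: "\<And>z. norm z < 1 \<Longrightarrow> u z = blaschke_factor l z ^ (p + 2) * h z"
  shows "(\<lambda>k. taylor_coeff u k *
           cnj (taylor_coeff (deriv (\<lambda>z. blaschke_factor l z ^ Suc p)) k)) sums 0"
proof -
  obtain \<rho> R where \<rho>: "0 < \<rho>" "norm l < \<rho>" "\<rho> < 1" "1 / \<rho> < R" "1 < R"
    and R: "\<And>z. z \<in> ball 0 R \<Longrightarrow> 1 - cnj l * z \<noteq> 0"
    using blaschke_radii[OF l] by metis
  define c where "c = - of_nat (Suc p) * (of_real (1 - (norm l)\<^sup>2) :: complex)"
  have "(\<lambda>z. c * z * h z / (1 - cnj l * z)\<^sup>2) holomorphic_on ball 0 1"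
    using blaschke_denominator_nonzero[OF l] by (intro holomorphic_intros h) auto
  then have "((\<lambda>z. c * z * h z / (1 - cnj l * z)\<^sup>2) has_contour_integral 0) (circlepath 0 \<rho>)"
    by (rule Cauchy_theorem_disc_simple) (use \<rho> in auto)
  then have "((\<lambda>z. u z * cnj (deriv (\<lambda>z. blaschke_factor l z ^ Suc p) (1 / cnj z)) / z)
      has_contour_integral 0) (circlepath 0 \<rho>)"
  proof (rule has_contour_integral_eq)
    fix z assume "z \<in> path_image (circlepath 0 \<rho>)"
    then have z: "norm z = \<rho>" using \<rho> by auto
    then have nz: "z \<noteq> 0" "z \<noteq> l" "1 - cnj l * z \<noteq> 0" "1 - cnj l * (1 / cnj z) \<noteq> 0"
      using \<rho> blaschke_denominator_nonzero[OF l, of z] R[of "1 / cnj z"] by (auto simp: norm_divide)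
    have b: "blaschke_factor l z \<noteq> 0"
      using nz by (auto simp: blaschke_factor_def)
    have "c * z * h z / (1 - cnj l * z)\<^sup>2 = c * z * h z * (blaschke_factor l z)\<^sup>2 / (z - l)\<^sup>2"
      using nz by (simp add: blaschke_factor_def power_divide power2_commute[of l z])
    also have "\<dots> = u z * (c * z\<^sup>2 / (blaschke_factor l z ^ p * (z - l)\<^sup>2)) / z"
      using nz b by (simp add: uh z \<rho> power_add power2_eq_square)
    finally show "c * z * h z / (1 - cnj l * z)\<^sup>2 =
        u z * cnj (deriv (\<lambda>z. blaschke_factor l z ^ Suc p) (1 / cnj z)) / z"
      unfolding cnj_deriv_blaschke_factor_power_reflect[OF nz(1,4)] c_def .
  qed
  then show ?thesis
    by (intro coeff_cnj_pairing_sums[OF u holomorphic_deriv_blaschke_factor_power[OF R] \<rho>(1,3,4)]) auto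
qed

text \<open>When the derivative is paired with itself, the powers
  \<open>blaschke_factor l z ^ p\<close> cancel and a double pole at l remains; the sum is its
  residue.\<close>

lemma H2_norm_deriv_blaschke_factor_power_sums:
  fixes p :: nat
  assumes l: "norm l < 1"
  shows "(\<lambda>k. (norm (taylor_coeff (deriv (\<lambda>z. blaschke_factor l z ^ Suc p)) k))\<^sup>2) sums
           ((real (Suc p))\<^sup>2 * (1 + (norm l)\<^sup>2) / (1 - (norm l)\<^sup>2))"
proof -
  obtain \<rho> R where \<rho>: "0 < \<rho>" "norm l < \<rho>" "\<rho> < 1" "1 / \<rho> < R" "1 < R"
    and R: "\<And>z. z \<in> ball 0 R \<Longrightarrow> 1 - cnj l * z \<noteq> 0"
    using blaschke_radii[OF l] by metis
  define F where "F = deriv (\<lambda>z. blaschke_factor l z ^ Suc p)"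
  define a :: complex where "a = of_real (1 - (norm l)\<^sup>2)"
  define c where "c = - of_nat (Suc p) * a"
  \<comment> \<open>The integrand of the pairing is G(z) / (z - l)^2, so its residue at l is
    G'(l).\<close>
  define G where "G z = c\<^sup>2 * z / (1 - cnj l * z)\<^sup>2" for z
  have a: "a = 1 - cnj l * l"
    by (simp only: a_def of_real_diff complex_norm_square of_real_1 mult.commute)
  have "a \<noteq> 0" using blaschke_denominator_nonzero[OF l, of l] l a by simp
  have F: "F holomorphic_on ball 0 R"
    unfolding F_def by (rule holomorphic_deriv_blaschke_factor_power[OF R])
  have G: "G holomorphic_on cball 0 \<rho>"
    unfolding G_def[abs_def] using \<rho> blaschke_denominator_nonzero[OF l] by (intro holomorphic_intros) auto
  have "(G has_field_derivative c\<^sup>2 * (1 + cnj l * l) / a ^ 3) (at l)"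
  proof -
    have "((\<lambda>z. (1 - cnj l * z)\<^sup>2) has_field_derivative - 2 * cnj l * a) (at l)"
      unfolding a by (auto intro!: derivative_eq_intros)
    moreover have "((\<lambda>z. c\<^sup>2 * z) has_field_derivative c\<^sup>2) (at l)"
      by (auto intro!: derivative_eq_intros)
    ultimately have "(G has_field_derivative
        (c\<^sup>2 * (1 - cnj l * l)\<^sup>2 - c\<^sup>2 * l * (- 2 * cnj l * a)) /
          ((1 - cnj l * l)\<^sup>2 * (1 - cnj l * l)\<^sup>2)) (at l)"
      unfolding G_def[abs_def] using \<open>a \<noteq> 0\<close> by (intro DERIV_divide) (auto simp flip: a)
    moreover have "(c\<^sup>2 * (1 - cnj l * l)\<^sup>2 - c\<^sup>2 * l * (- 2 * cnj l * a)) /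
          ((1 - cnj l * l)\<^sup>2 * (1 - cnj l * l)\<^sup>2) = c\<^sup>2 * (a + 2 * (cnj l * l)) / a ^ 3"
      unfolding a[symmetric] using \<open>a \<noteq> 0\<close>
      by (simp add: divide_simps)
        (simp add: algebra_simps power2_eq_square power3_eq_cube power4_eq_xxxx)
    moreover have "a + 2 * (cnj l * l) = 1 + cnj l * l"
      by (simp add: a)
    ultimately show ?thesis by simp
  qed
  then have dG: "deriv G l = c\<^sup>2 * (1 + cnj l * l) / a ^ 3"
    by (rule DERIV_imp_deriv)
  have "((\<lambda>z. G z / (z - l) ^ Suc 1) has_contour_integral 2 * pi * \<i> / fact 1 * (deriv ^^ 1) G l)
      (circlepath 0 \<rho>)"
    by (rule Cauchy_has_contour_integral_higher_derivative_circlepath)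
      (use G \<rho> in \<open>auto intro: holomorphic_on_imp_continuous_on elim: holomorphic_on_subset\<close>)
  then have "((\<lambda>z. F z * cnj (F (1 / cnj z)) / z) has_contour_integral
      2 * pi * \<i> / fact 1 * (deriv ^^ 1) G l) (circlepath 0 \<rho>)"
  proof (rule has_contour_integral_eq)
    fix z assume "z \<in> path_image (circlepath 0 \<rho>)"
    then have z: "norm z = \<rho>" using \<rho> by auto
    then have nz: "z \<noteq> 0" "z \<noteq> l" "1 - cnj l * z \<noteq> 0" "1 - cnj l * (1 / cnj z) \<noteq> 0"
      using \<rho> blaschke_denominator_nonzero[OF l, of z] R[of "1 / cnj z"] by (auto simp: norm_divide)
    have b: "blaschke_factor l z \<noteq> 0"
      using nz by (auto simp: blaschke_factor_def)
    have "G z / (z - l) ^ Suc 1 = c * blaschke_factor l z ^ p / (1 - cnj l * z)\<^sup>2 *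
        (c * z\<^sup>2 / (blaschke_factor l z ^ p * (z - l)\<^sup>2)) / z"
      unfolding G_def using nz(1) b by (simp add: power2_eq_square mult_ac)
    then show "G z / (z - l) ^ Suc 1 = F z * cnj (F (1 / cnj z)) / z"
      unfolding F_def cnj_deriv_blaschke_factor_power_reflect[OF nz(1,4)]
        deriv_blaschke_factor_power[OF nz(3)] a_def[symmetric] c_def[symmetric] .
  qed
  then have "(\<lambda>k. taylor_coeff F k * cnj (taylor_coeff F k)) sums deriv G l"
    by (intro coeff_cnj_pairing_sums[OF _ F \<rho>(1,3,4)])
      (use F \<rho> in \<open>auto elim: holomorphic_on_subset\<close>)
  moreover have "deriv G l = of_real ((real (Suc p))\<^sup>2 * (1 + (norm l)\<^sup>2) / (1 - (norm l)\<^sup>2))"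
  proof -
    have "cnj l * l = of_real ((norm l)\<^sup>2)"
      by (simp only: complex_norm_square mult.commute)
    moreover have "of_real ((real (Suc p))\<^sup>2 * (1 + (norm l)\<^sup>2) / (1 - (norm l)\<^sup>2))
        = (of_nat (Suc p))\<^sup>2 * (1 + of_real ((norm l)\<^sup>2)) / a"
      by (simp add: a_def)
    \<comment> \<open>Here \<open>c\<close> is -(p + 1) a, so two of the three factors
      \<open>a\<close> in the denominator cancel.\<close>
    moreover have "c\<^sup>2 * x / a ^ 3 = (of_nat (Suc p))\<^sup>2 * x / a" for x
      unfolding c_def using \<open>a \<noteq> 0\<close>
      by (simp add: power2_eq_square power3_eq_cube del: of_nat_Suc)
    ultimately show ?thesis
      unfolding dG by metis
  qed
  ultimately have "(\<lambda>k. of_real ((norm (taylor_coeff F k))\<^sup>2)) sums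
      (of_real ((real (Suc p))\<^sup>2 * (1 + (norm l)\<^sup>2) / (1 - (norm l)\<^sup>2)) :: complex)"
    by (simp only: complex_norm_square)
  then show ?thesis
    by (simp only: sums_of_real_iff F_def)
qed

text \<open>With B the power and F = B', F_k = (k + 1) B_(k+1), so each term equals F_k * cnj
  B_(k+1). The sum therefore pairs B' with the shifted coefficients of B. Up to a term of zero
  integral the integrand is B' / B, and the argument principle predicts the value: B has a zero of
  order p + 1 at l.\<close>

lemma Dirichlet_dual_norm_deriv_blaschke_factor_power_sums:
  fixes p :: nat
  assumes l: "norm l < 1"
  shows "(\<lambda>k. (norm (taylor_coeff (deriv (\<lambda>z. blaschke_factor l z ^ Suc p)) k))\<^sup>2 / real (k + 1))
           sums real (Suc p)"
proof -
  obtain \<rho> R where \<rho>: "0 < \<rho>" "norm l < \<rho>" "\<rho> < 1" "1 / \<rho> < R" "1 < R"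
    and R: "\<And>z. z \<in> ball 0 R \<Longrightarrow> 1 - cnj l * z \<noteq> 0"
    using blaschke_radii[OF l] by metis
  define B where "B = (\<lambda>z. blaschke_factor l z ^ Suc p)"
  define a :: complex where "a = of_real (1 - (norm l)\<^sup>2)"
  \<comment> \<open>No minus sign here: the pole will be written with z - l instead of l -
    z.\<close>
  define c where "c = of_nat (Suc p) * a"
  define d where "d k = cnj (taylor_coeff B (Suc k))" for k
  \<comment> \<open>Dropping the constant term of the reflected series and multiplying by z realises
    the index shift in \<open>d\<close>.\<close>
  define V where "V z = z * (cnj (B (1 / cnj z)) - cnj (taylor_coeff B 0))" for z
  have a: "a = 1 - cnj l * l"
    by (simp only: a_def of_real_diff complex_norm_square of_real_1 mult.commute)
  have "a \<noteq> 0" using blaschke_denominator_nonzero[OF l, of l] l a by simp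
  have B: "B holomorphic_on ball 0 R"
    unfolding B_def by (intro holomorphic_on_power holomorphic_blaschke_factor R)
  have F: "deriv B holomorphic_on ball 0 1"
    by (rule holomorphic_on_subset[OF holomorphic_deriv[OF B]]) (use \<rho> in auto)
  have d: "summable (\<lambda>k. norm (d k) / \<rho> ^ k)"
  proof -
    have "summable (\<lambda>k. norm (taylor_coeff B (Suc k)) / \<rho> ^ Suc k)"
      using summable_norm_taylor_coeff_divide[OF B \<rho>(1,4)] by (subst summable_Suc_iff)
    from summable_mult[OF this, of \<rho>] show ?thesis
      using \<rho> by (simp add: d_def)
  qed
  have V: "(\<lambda>k. d k / z ^ k) sums V z" if z: "norm z = \<rho>" for z
  proof -
    have "(\<lambda>k. cnj (taylor_coeff B (Suc k)) / z ^ Suc k) sums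
        (cnj (B (1 / cnj z)) - cnj (taylor_coeff B 0))"
      using cnj_taylor_coeff_sums[OF B \<rho>(4) z] by (subst sums_Suc_iff) simp
    from sums_mult[OF this, of z] show ?thesis
      using z \<rho> by (auto simp: d_def V_def)
  qed
  \<comment> \<open>This integrand is B' / B; its residue at l is c / a = p + 1.\<close>
  have "((\<lambda>z. c / (1 - cnj l * z) / (z - l)) has_contour_integral
      2 * pi * \<i> * (c / (1 - cnj l * l))) (circlepath 0 \<rho>)"
  proof -
    have "(\<lambda>z. c / (1 - cnj l * z)) holomorphic_on cball 0 \<rho>"
      using \<rho> blaschke_denominator_nonzero[OF l] by (intro holomorphic_intros) auto
    from Cauchy_integral_circlepath_simple[OF this, of l] show ?thesis
      using \<rho> by simp
  qed
  \<comment> \<open>The contribution of the constant term subtracted in \<open>V\<close> is a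
    multiple of the integral of B', which vanishes.\<close>
  moreover have "((\<lambda>z. cnj (taylor_coeff B 0) * deriv B z) has_contour_integral 0) (circlepath 0 \<rho>)"
    by (rule Cauchy_theorem_disc_simple[OF holomorphic_on_mult[OF holomorphic_on_const F]])
      (use \<rho> in auto)
  ultimately have "((\<lambda>z. c / (1 - cnj l * z) / (z - l) - cnj (taylor_coeff B 0) * deriv B z)
      has_contour_integral 2 * pi * \<i> * (c / (1 - cnj l * l)) - 0) (circlepath 0 \<rho>)"
    by (rule has_contour_integral_diff)
  then have "((\<lambda>z. deriv B z * V z / z) has_contour_integral
      2 * pi * \<i> * (c / (1 - cnj l * l)) - 0) (circlepath 0 \<rho>)"
  proof (rule has_contour_integral_eq)
    fix z assume "z \<in> path_image (circlepath 0 \<rho>)"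
    then have z: "norm z = \<rho>" using \<rho> by auto
    then have nz: "z \<noteq> 0" "z \<noteq> l" "1 - cnj l * z \<noteq> 0"
      using \<rho> blaschke_denominator_nonzero[OF l, of z] by auto
    have b: "blaschke_factor l z \<noteq> 0"
      using nz by (auto simp: blaschke_factor_def)
    have "deriv B z = - c * blaschke_factor l z ^ p / (1 - cnj l * z)\<^sup>2"
      unfolding B_def deriv_blaschke_factor_power[OF nz(3)] c_def a_def by (simp del: of_nat_Suc)
    moreover have "cnj (B (1 / cnj z)) = 1 / blaschke_factor l z ^ Suc p"
      unfolding B_def complex_cnj_power blaschke_factor_reflect[OF nz(1)] by (rule power_one_over)
    ultimately have "deriv B z * cnj (B (1 / cnj z)) =
        - c * (blaschke_factor l z ^ p / blaschke_factor l z ^ Suc p) / (1 - cnj l * z)\<^sup>2"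
      by (simp add: mult.commute)
    also have "blaschke_factor l z ^ p / blaschke_factor l z ^ Suc p = (1 - cnj l * z) / (l - z)"
      using b by (simp add: blaschke_factor_def)
    also have "- c * ((1 - cnj l * z) / (l - z)) / (1 - cnj l * z)\<^sup>2 = c / (1 - cnj l * z) / (z - l)"
      using nz by (simp add: divide_simps power2_eq_square) (simp add: algebra_simps)
    finally have "deriv B z * cnj (B (1 / cnj z)) = c / (1 - cnj l * z) / (z - l)" .
    moreover have "deriv B z * V z / z =
        deriv B z * cnj (B (1 / cnj z)) - cnj (taylor_coeff B 0) * deriv B z"
      using nz by (simp add: V_def right_diff_distrib diff_divide_distrib)
    ultimately show "c / (1 - cnj l * z) / (z - l) - cnj (taylor_coeff B 0) * deriv B z =
        deriv B z * V z / z"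
      by (simp only:)
  qed
  then have "(\<lambda>k. taylor_coeff (deriv B) k * d k) sums (c / (1 - cnj l * l))"
    by (intro coeff_pairing_sums[OF F \<rho>(1,3) d V]) auto
  moreover have "c / (1 - cnj l * l) = of_real (real (Suc p))"
    using \<open>a \<noteq> 0\<close> by (simp add: c_def flip: a)
  moreover have "taylor_coeff (deriv B) k * d k =
      of_real ((norm (taylor_coeff (deriv B) k))\<^sup>2 / real (k + 1))" for k
    by (simp add: taylor_coeff_deriv d_def norm_mult power_mult_distrib power2_eq_square
        complex_norm_square[symmetric] del: of_nat_Suc)
  ultimately show ?thesis
    by (simp only: sums_of_real_iff B_def)
qed

section \<open>Duality and the lower bound\<close>

text \<open>Split each term as (sqrt w * x) * (y / sqrt w), apply the finite Cauchy-Schwarz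
  inequality to partial sums and pass to the limit. With w k = k + 1 the first factor is the
  Dirichlet norm.\<close>

lemma norm_sums_le_weighted_Cauchy_Schwarz:
  fixes x y :: "nat \<Rightarrow> complex" and w :: "nat \<Rightarrow> real"
  assumes s: "(\<lambda>k. x k * y k) sums s" and w: "\<And>k. w k > 0"
    and x: "summable (\<lambda>k. w k * (norm (x k))\<^sup>2)" and y: "(\<lambda>k. (norm (y k))\<^sup>2 / w k) sums D"
  shows "norm s \<le> sqrt (\<Sum>k. w k * (norm (x k))\<^sup>2) * sqrt D"
proof (rule LIMSEQ_le_const2)
  show "(\<lambda>K. norm (\<Sum>k<K. x k * y k)) \<longlonglongrightarrow> norm s"
    using s by (intro tendsto_norm) (simp add: sums_def)
  have "norm (\<Sum>k<K. x k * y k) \<le> sqrt (\<Sum>k. w k * (norm (x k))\<^sup>2) * sqrt D" for K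
  proof -
    have "norm (\<Sum>k<K. x k * y k) \<le> (\<Sum>k<K. norm (x k * y k))"
      by (rule norm_sum)
    also have "\<dots> = (\<Sum>k<K. \<bar>sqrt (w k) * norm (x k)\<bar> * \<bar>norm (y k) / sqrt (w k)\<bar>)"
      using w by (intro sum.cong refl) (simp add: norm_mult abs_mult less_imp_neq[symmetric] less_imp_le)
    also have "\<dots> \<le> L2_set (\<lambda>k. sqrt (w k) * norm (x k)) {..<K} * L2_set (\<lambda>k. norm (y k) / sqrt (w k)) {..<K}"
      by (rule L2_set_mult_ineq)
    also have "\<dots> = sqrt (\<Sum>k<K. w k * (norm (x k))\<^sup>2) * sqrt (\<Sum>k<K. (norm (y k))\<^sup>2 / w k)"
      using w by (simp add: L2_set_def power_mult_distrib power_divide less_imp_le)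
    also have "\<dots> \<le> sqrt (\<Sum>k. w k * (norm (x k))\<^sup>2) * sqrt D"
    proof (intro mult_mono real_sqrt_le_mono)
      show "(\<Sum>k<K. w k * (norm (x k))\<^sup>2) \<le> (\<Sum>k. w k * (norm (x k))\<^sup>2)"
        using w by (intro sum_le_suminf x) (auto simp: less_imp_le)
      then show "0 \<le> sqrt (\<Sum>k. w k * (norm (x k))\<^sup>2)"
        using w by (intro real_sqrt_ge_zero suminf_nonneg x) (auto simp: less_imp_le)
      show "(\<Sum>k<K. (norm (y k))\<^sup>2 / w k) \<le> D"
        using w y unfolding sums_iff by (metis (no_types, lifting) divide_nonneg_pos finite_lessThan sum_le_suminf zero_le_power2)
    qed (use w in \<open>auto intro!: sum_nonneg simp: less_imp_le\<close>)
    finally show ?thesis .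
  qed
  then show "\<exists>N. \<forall>K\<ge>N. norm (\<Sum>k<K. x k * y k) \<le> sqrt (\<Sum>k. w k * (norm (x k))\<^sup>2) * sqrt D"
    by blast
qed

lemma interp_const_lower_bound:
  fixes p :: nat
  assumes l: "norm l < 1"
  shows "ereal (sqrt (real (Suc p) * (1 + (norm l)\<^sup>2) / (1 - (norm l)\<^sup>2)))
         \<le> interp_const (replicate (p + 2) l) in_H2 H2_norm in_Dirichlet Dirichlet_norm"
proof -
  define F where "F = deriv (\<lambda>z. blaschke_factor l z ^ Suc p)"
  define S where "S = (real (Suc p))\<^sup>2 * (1 + (norm l)\<^sup>2) / (1 - (norm l)\<^sup>2)"
  define f where "f z = of_real (1 / sqrt S) * F z" for z
  have "(norm l)\<^sup>2 < 1"
    using l by (simp add: power_less_one_iff)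
  then have S: "S > 0"
    unfolding S_def by (intro divide_pos_pos mult_pos_pos add_pos_nonneg) auto
  have F: "F holomorphic_on ball 0 1"
    unfolding F_def using blaschke_denominator_nonzero[OF l]
    by (intro holomorphic_deriv_blaschke_factor_power) auto
  have f: "f holomorphic_on ball 0 1"
    unfolding f_def[abs_def] by (intro holomorphic_intros F)
  have f_coeff: "taylor_coeff f k = of_real (1 / sqrt S) * taylor_coeff F k" for k
    unfolding f_def[abs_def] by (rule taylor_coeff_cmult[OF F])
  have F_sums: "(\<lambda>k. (norm (taylor_coeff F k))\<^sup>2) sums S"
    using H2_norm_deriv_blaschke_factor_power_sums[OF l, of p] unfolding F_def S_def .
  have "(\<lambda>k. (norm (taylor_coeff f k))\<^sup>2) sums (1 / S * S)"
    using sums_mult[OF F_sums, of "1 / S"] S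
    by (simp add: f_coeff norm_mult power_mult_distrib power_divide norm_divide)
  then have f_norm: "in_H2 f" "H2_norm f \<le> 1"
    using f S by (auto simp: in_H2_def H2_norm_def sums_iff)
  \<comment> \<open>It suffices to bound every admissible \<open>g\<close> for this one
    \<open>f\<close>.\<close>
  have "sqrt (real (Suc p) * (1 + (norm l)\<^sup>2) / (1 - (norm l)\<^sup>2)) \<le> Dirichlet_norm g"
    if g: "in_Dirichlet g" "same_trace (replicate (p + 2) l) f g" for g
  proof -
    obtain h where h: "h holomorphic_on ball 0 1"
      and fgh: "\<And>z. norm z < 1 \<Longrightarrow> f z - g z = blaschke_factor l z ^ (p + 2) * h z"
      using g(2) by (auto simp: same_trace_def blaschke_prod_def prod_list_replicate)
    have g': "g holomorphic_on ball 0 1" "summable (\<lambda>k. real (k + 1) * (norm (taylor_coeff g k))\<^sup>2)"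
      using g(1) by (auto simp: in_Dirichlet_def)
    \<comment> \<open>The difference f - g is orthogonal to \<open>F\<close>, so \<open>g\<close>
      inherits the pairing of \<open>f\<close> with \<open>F\<close>, which is S / sqrt S = sqrt
      S.\<close>
    have "(\<lambda>k. taylor_coeff (\<lambda>z. f z - g z) k * cnj (taylor_coeff F k)) sums 0"
      unfolding F_def
      by (rule pairing_blaschke_multiple_sums_0[OF l h holomorphic_on_diff[OF f g'(1)] fgh])
    then have diff: "(\<lambda>k. (taylor_coeff f k - taylor_coeff g k) * cnj (taylor_coeff F k)) sums 0"
      by (simp only: taylor_coeff_diff[OF f g'(1)])
    have "(\<lambda>k. of_real (1 / sqrt S * (norm (taylor_coeff F k))\<^sup>2) :: complex) sums of_real (1 / sqrt S * S)"
      unfolding sums_of_real_iff by (rule sums_mult[OF F_sums])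
    then have "(\<lambda>k. taylor_coeff f k * cnj (taylor_coeff F k)) sums of_real (1 / sqrt S * S)"
      by (simp only: f_coeff of_real_mult complex_norm_square mult.assoc)
    also have "1 / sqrt S * S = sqrt S"
      using S by (simp add: real_div_sqrt)
    finally have "(\<lambda>k. taylor_coeff g k * cnj (taylor_coeff F k)) sums of_real (sqrt S)"
      using sums_diff[OF _ diff, of "\<lambda>k. taylor_coeff f k * cnj (taylor_coeff F k)" "of_real (sqrt S)"]
      by (simp add: left_diff_distrib)
    then have "norm (of_real (sqrt S) :: complex) \<le> Dirichlet_norm g * sqrt (real (Suc p))"
      unfolding Dirichlet_norm_def
      by (rule norm_sums_le_weighted_Cauchy_Schwarz)
        (use g' Dirichlet_dual_norm_deriv_blaschke_factor_power_sums[OF l, of p]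
          in \<open>simp_all add: F_def del: of_nat_Suc\<close>)
    then have "sqrt S / sqrt (real (Suc p)) \<le> Dirichlet_norm g"
      using S by (simp add: divide_le_eq del: of_nat_Suc)
    also have "sqrt S / sqrt (real (Suc p)) = sqrt (real (Suc p) * (1 + (norm l)\<^sup>2) / (1 - (norm l)\<^sup>2))"
      unfolding real_sqrt_divide[symmetric] S_def by (simp add: power2_eq_square del: of_nat_Suc)
    finally show ?thesis .
  qed
  then show ?thesis
    unfolding interp_const_def
    by (intro SUP_upper2[of f] INF_greatest) (use f_norm in auto)
qed

section \<open>Comparison with the stated constant\<close>

theorem theoremB:
  fixes n :: nat and l :: complex
  assumes "n \<ge> 1" and "norm l < 1"
    and "((1 + norm l)\<^sup>2 - 2 / real n - 2 * norm l / real n) / (2 * (1 + norm l)) \<ge> 0"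
  shows "ereal (sqrt (real n / (1 - norm l)) *
           sqrt (((1 + norm l)\<^sup>2 - 2 / real n - 2 * norm l / real n) / (2 * (1 + norm l))))
         \<le> interp_const (replicate n l) in_H2 H2_norm in_Dirichlet Dirichlet_norm"
proof -
  define r where "r = norm l"
  have r: "0 \<le> r" "r < 1"
    using assms(2) by (auto simp: r_def)
  have bound: "real n / (1 - r) * (((1 + r)\<^sup>2 - 2 / real n - 2 * r / real n) / (2 * (1 + r)))
      = (real n * (1 + r) - 2) / (2 * (1 - r))"
  proof -
    have "(1 + r)\<^sup>2 - 2 / real n - 2 * r / real n = (1 + r) * (real n * (1 + r) - 2) / real n"
      using assms(1) by (simp add: field_simps power2_eq_square)
    moreover have "real n / (1 - r) * ((1 + r) * x / real n / (2 * (1 + r))) = x / (2 * (1 - r))" for x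
      using assms(1) r by (simp add: divide_simps) (simp add: algebra_simps)
    ultimately show ?thesis by simp
  qed
  \<comment> \<open>Nonnegativity of the bracket becomes n (1 + r) \<ge> 2, which together with r <
    1 excludes n = 1.\<close>
  have "0 \<le> real n / (1 - r) * (((1 + r)\<^sup>2 - 2 / real n - 2 * r / real n) / (2 * (1 + r)))"
    using assms(3) r by (intro mult_nonneg_nonneg) (auto simp: r_def)
  then have "2 \<le> real n * (1 + r)"
    unfolding bound using r by (simp add: zero_le_divide_iff)
  then have "n \<noteq> 1"
    using r by auto
  then have "n = (n - 2) + 2"
    using assms(1) by simp
  then obtain p where n: "n = p + 2" ..
  have "(real n * (1 + r) - 2) / (2 * (1 - r)) \<le> real (Suc p) * (1 + r\<^sup>2) / (1 - r\<^sup>2)"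
  proof -
    \<comment> \<open>After multiplication by 2 (1 - r^2), the two bounds differ by exactly (p + 1)
      (1 - r)^2 + (1 - r^2), a sum of nonnegative terms.\<close>
    have "(1 + r) * (real n * (1 + r) - 2) + real (Suc p) * (1 - r)\<^sup>2 + (1 - r\<^sup>2)
        = 2 * (real (Suc p) * (1 + r\<^sup>2))"
      by (simp add: n algebra_simps power2_eq_square)
    moreover have "0 \<le> real (Suc p) * (1 - r)\<^sup>2" "0 \<le> 1 - r\<^sup>2"
      using r by (auto simp: power_le_one)
    ultimately have le: "(1 + r) * (real n * (1 + r) - 2) \<le> 2 * (real (Suc p) * (1 + r\<^sup>2))"
      by linarith
    have "(real n * (1 + r) - 2) / (2 * (1 - r)) =
        (1 + r) * (real n * (1 + r) - 2) / ((1 + r) * (2 * (1 - r)))"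
      using r by simp
    also have "\<dots> \<le> 2 * (real (Suc p) * (1 + r\<^sup>2)) / ((1 + r) * (2 * (1 - r)))"
      using r le by (intro divide_right_mono) auto
    also have "(1 + r) * (2 * (1 - r)) = 2 * (1 - r\<^sup>2)"
      by (simp add: algebra_simps power2_eq_square)
    also have "2 * (real (Suc p) * (1 + r\<^sup>2)) / (2 * (1 - r\<^sup>2)) = real (Suc p) * (1 + r\<^sup>2) / (1 - r\<^sup>2)"
      by (rule mult_divide_mult_cancel_left) simp
    finally show ?thesis .
  qed
  then have "ereal (sqrt (real n / (1 - r)) *
           sqrt (((1 + r)\<^sup>2 - 2 / real n - 2 * r / real n) / (2 * (1 + r))))
      \<le> ereal (sqrt (real (Suc p) * (1 + r\<^sup>2) / (1 - r\<^sup>2)))"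
    unfolding real_sqrt_mult[symmetric] bound by simp
  also have "\<dots> \<le> interp_const (replicate n l) in_H2 H2_norm in_Dirichlet Dirichlet_norm"
    unfolding n r_def by (rule interp_const_lower_bound[OF assms(2)])
  finally show ?thesis
    unfolding r_def .
qed

end
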